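(* Let $n\ge1$, let $\varepsilon\in(0,1)$, let $\Sigma\in\mathbb{R}^{n\times n}$ be a covariance matrix (symmetric positive semidefinite), and let $\mathcal{P}$ be the set of all probability distributions on $\mathbb{R}^n$ with mean $\mu=0$ and covariance matrix $\Sigma$. Then for every $q=(q_1,\dots,q_n)^\top\in\mathbb{R}^n$, with $\xi=(\xi_1,\dots,\xi_n)^\top$, $$\sup_{\mathbb{P}\in\mathcal{P}}\mathbb{P}\text{-CVaR}_{\varepsilon}[q^\top\xi]\le\sum_{i=1}^n|q_i|\,\sup_{\mathbb{P}\in\mathcal{P}}\mathbb{P}\text{-CVaR}_{\varepsilon}[\xi_i].$$
   Context: For a measurable loss function $L:\mathbb{R}^n\to\mathbb{R}$, a probability distribution $\mathbb{P}$ on $\mathbb{R}^n$ (the law of the random vector $\xi$) and a level $\varepsilon\in(0,1)$, the Conditional Value-at-Risk is $$\mathbb{P}\text{-CVaR}_{\varepsilon}[L(\xi)]=\inf_{\beta\in\mathbb{R}}\left\{\beta+\frac1\varepsilon\,\mathbb{E}_{\mathbb{P}}\big[(L(\xi)-\beta)^+\big]\right\},$$ where $(a)^+=\max(a,0)$. The worst-case CVaR over $\mathcal{P}$ is the supremum of this quantity over $\mathbb{P}\in\mathcal{P}$. *)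

theory Defs
  imports "HOL-Probability.Probability"
begin

(* The expectation of the nonnegative excess loss is a nonnegative Lebesgue integral, so it is
   infinite (and not 0, as a Bochner integral would be) when the excess is not integrable.
   CVaR and its suprema therefore live in the complete lattice of extended reals. *)
definition CVaR :: "'a measure \<Rightarrow> real \<Rightarrow> ('a \<Rightarrow> real) \<Rightarrow> ereal" where
  "CVaR P \<epsilon> L =
     (INF \<beta>::real. ereal \<beta> + ereal (1 / \<epsilon>) * enn2ereal (\<integral>\<^sup>+ x. ennreal (max (L x - \<beta>) 0) \<partial>P))"

definition worst_case_CVaR :: "'a measure set \<Rightarrow> real \<Rightarrow> ('a \<Rightarrow> real) \<Rightarrow> ereal" where
  "worst_case_CVaR \<P> \<epsilon> L = (SUP P\<in>\<P>. CVaR P \<epsilon> L)"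

definition mean_vector :: "(real ^ 'n) measure \<Rightarrow> real ^ 'n" where
  "mean_vector P = (\<integral>x. x \<partial>P)"

definition covariance_matrix :: "(real ^ 'n) measure \<Rightarrow> real ^ 'n ^ 'n" where
  "covariance_matrix P =
     (\<chi> i j. \<integral>x. (x $ i - mean_vector P $ i) * (x $ j - mean_vector P $ j) \<partial>P)"

(* Square integrability makes the mean and the covariance matrix exist; without it
   the Bochner integrals above could take their default value 0. *)
definition distributions_with_moments ::
    "real ^ 'n \<Rightarrow> real ^ 'n ^ 'n \<Rightarrow> (real ^ 'n) measure set" where
  "distributions_with_moments \<mu> \<Sigma> =
     {P. prob_space P \<and> sets P = sets borel \<and> integrable P (\<lambda>x. (norm x)\<^sup>2) \<and>
         mean_vector P = \<mu> \<and> covariance_matrix P = \<Sigma>}"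

definition symmetric_psd :: "real ^ 'n ^ 'n \<Rightarrow> bool" where
  "symmetric_psd A \<longleftrightarrow> transpose A = A \<and> (\<forall>x. 0 \<le> x \<bullet> (A *v x))"

end

theory Submission
  imports Defs
begin

text \<open>CVaR is sublinear, so the CVaR of \<open>q \<bullet> \<xi>\<close> is at most the sum over \<open>i\<close> of
  \<open>\<bar>q\<^sub>i\<bar>\<close> times the CVaR of \<open>sgn q\<^sub>i \<cdot> \<xi>\<^sub>i\<close>. As the mean is zero, the ambiguity set
  is closed under the reflection \<open>\<xi> \<mapsto> - \<xi>\<close>, which turns the CVaR of \<open>- \<xi>\<^sub>i\<close> into
  that of \<open>\<xi>\<^sub>i\<close>. No closed formula for the worst-case CVaR is required.\<close>

text \<open>Fix \<open>i\<close> and pass to the infimum over \<open>j\<close>, then to the one over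
  \<open>i\<close>. Each passage moves the other summand across the inequality, which is done in
  \<open>ereal\<close> for finite summands; infinite ones are split off, using that \<infinity> + x
  = \<infinity> even for x = -\<infinity>.\<close>

lemma le_INF_add_INF_ereal:
  fixes f :: "'a \<Rightarrow> ereal" and g :: "'b \<Rightarrow> ereal"
  assumes le: "\<And>i j. i \<in> I \<Longrightarrow> j \<in> J \<Longrightarrow> c \<le> f i + g j"
    and f: "\<And>i. i \<in> I \<Longrightarrow> f i \<noteq> -\<infinity>"
  shows "c \<le> (INF i\<in>I. f i) + (INF j\<in>J. g j)"
proof -
  have c_le: "c \<le> f i + (INF j\<in>J. g j)" if i: "i \<in> I" for i
  proof (cases "f i")
    case (real r)
    have "c - ereal r \<le> (INF j\<in>J. g j)"
      using le[OF i] real by (intro INF_greatest) (simp add: ereal_minus_le add.commute)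
    then show ?thesis
      using real by (simp add: ereal_minus_le add.commute)
  qed (use f[OF i] in auto)
  show ?thesis
  proof (cases "INF j\<in>J. g j")
    case (real r)
    have "c - ereal r \<le> (INF i\<in>I. f i)"
      using c_le real by (intro INF_greatest) (simp add: ereal_minus_le)
    then show ?thesis
      using real by (simp add: ereal_minus_le)
  next
    case MInf
    show ?thesis
    \<comment> \<open>The second infimum is -\<infinity>. One value of \<open>f\<close> below
      \<infinity> then forces \<open>c\<close> down to -\<infinity>; otherwise the first infimum is
      \<infinity> and absorbs the second.\<close>
    proof (cases "\<exists>i\<in>I. f i \<noteq> \<infinity>")
      case True
      then obtain i where "i \<in> I" "f i \<noteq> \<infinity>" by blast
      with c_le[of i] MInf have "c = -\<infinity>" by (cases "f i") auto
      then show ?thesis by simp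
    next
      case False
      then have "(INF i\<in>I. f i) = \<infinity>"
        by (auto simp: top_ereal_def[symmetric] intro!: INF_eqI)
      then show ?thesis by simp
    qed
  qed simp
qed

lemma CVaR_le:
  "CVaR P \<epsilon> L \<le>
    ereal \<beta> + ereal (1 / \<epsilon>) * enn2ereal (\<integral>\<^sup>+ x. ennreal (max (L x - \<beta>) 0) \<partial>P)"
  unfolding CVaR_def by (rule INF_lower) simp

text \<open>The witness is the level 0. Since \<open>P\<close> is arbitrary, equality can fail: for
  the zero measure the infimum is -\<infinity>.\<close>

lemma CVaR_zero_le: "CVaR P \<epsilon> (\<lambda>x. 0) \<le> 0"
proof -
  have "enn2ereal 0 = 0"
    by (rule zero_ennreal.rep_eq)
  then have "CVaR P \<epsilon> (\<lambda>x. 0) \<le> ereal 0"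
    using CVaR_le[of P \<epsilon> "\<lambda>x. 0" 0] by simp
  then show ?thesis
    by (simp only: zero_ereal_def)
qed

text \<open>If \<beta> and \<gamma> are levels for the two losses, then \<beta> + \<gamma> is a
  candidate level for their sum, and the positive part is subadditive. The two levels vary
  independently, so both infima can be taken.\<close>

lemma CVaR_add_le:
  assumes "0 < \<epsilon>" and [measurable]: "L \<in> borel_measurable P" "M \<in> borel_measurable P"
  shows "CVaR P \<epsilon> (\<lambda>x. L x + M x) \<le> CVaR P \<epsilon> L + CVaR P \<epsilon> M"
proof -
  let ?E = "\<lambda>L \<beta>. \<integral>\<^sup>+ x. ennreal (max (L x - \<beta>) 0) \<partial>P"
  let ?h = "\<lambda>L \<beta>. ereal \<beta> + ereal (1 / \<epsilon>) * enn2ereal (?E L \<beta>)"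
  have rearrange: "ereal (b + c) + (y + z) = (ereal b + y) + (ereal c + z)"
    for b c :: real and y z :: ereal
    by (cases y; cases z) auto
  have "CVaR P \<epsilon> (\<lambda>x. L x + M x) \<le> ?h L \<beta> + ?h M \<gamma>" for \<beta> \<gamma>
  proof -
    have "?E (\<lambda>x. L x + M x) (\<beta> + \<gamma>)
        \<le> (\<integral>\<^sup>+ x. ennreal (max (L x - \<beta>) 0) + ennreal (max (M x - \<gamma>) 0) \<partial>P)"
    proof (rule nn_integral_mono)
      fix x
      have "max (L x + M x - (\<beta> + \<gamma>)) 0 \<le> max (L x - \<beta>) 0 + max (M x - \<gamma>) 0"
        by linarith
      then have "ennreal (max (L x + M x - (\<beta> + \<gamma>)) 0)
          \<le> ennreal (max (L x - \<beta>) 0 + max (M x - \<gamma>) 0)"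
        by (rule ennreal_leI)
      also have "\<dots> = ennreal (max (L x - \<beta>) 0) + ennreal (max (M x - \<gamma>) 0)"
        by (rule ennreal_plus) auto
      finally show "ennreal (max (L x + M x - (\<beta> + \<gamma>)) 0)
          \<le> ennreal (max (L x - \<beta>) 0) + ennreal (max (M x - \<gamma>) 0)" .
    qed
    also have "\<dots> = ?E L \<beta> + ?E M \<gamma>"
      by (rule nn_integral_add) auto
    finally have "enn2ereal (?E (\<lambda>x. L x + M x) (\<beta> + \<gamma>))
        \<le> enn2ereal (?E L \<beta>) + enn2ereal (?E M \<gamma>)"
      by (simp add: less_eq_ennreal.rep_eq plus_ennreal.rep_eq)
    then have "ereal (1 / \<epsilon>) * enn2ereal (?E (\<lambda>x. L x + M x) (\<beta> + \<gamma>))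
        \<le> ereal (1 / \<epsilon>) * (enn2ereal (?E L \<beta>) + enn2ereal (?E M \<gamma>))"
      using \<open>0 < \<epsilon>\<close> by (intro ereal_mult_left_mono) auto
    also have "\<dots> = ereal (1 / \<epsilon>) * enn2ereal (?E L \<beta>) + ereal (1 / \<epsilon>) * enn2ereal (?E M \<gamma>)"
      \<comment> \<open>Distributivity is available in \<open>ereal\<close> here because both
        integrals are nonnegative.\<close>
      by (rule ereal_right_distrib) auto
    finally have "?h (\<lambda>x. L x + M x) (\<beta> + \<gamma>) \<le> ereal (\<beta> + \<gamma>) +
        (ereal (1 / \<epsilon>) * enn2ereal (?E L \<beta>) + ereal (1 / \<epsilon>) * enn2ereal (?E M \<gamma>))"
      by (rule add_left_mono)
    also have "\<dots> = ?h L \<beta> + ?h M \<gamma>"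
      by (rule rearrange)
    finally show ?thesis
      by (rule order_trans[OF CVaR_le])
  qed
  moreover have "?h L \<beta> \<noteq> -\<infinity>" for \<beta>
  proof -
    have "0 \<le> ereal (1 / \<epsilon>) * enn2ereal (?E L \<beta>)"
      using \<open>0 < \<epsilon>\<close> by (intro ereal_0_le_mult) auto
    then show ?thesis by auto
  qed
  ultimately show ?thesis
    unfolding CVaR_def[of P \<epsilon> L] CVaR_def[of P \<epsilon> M] by (intro le_INF_add_INF_ereal) auto
qed

text \<open>For positive \<open>a\<close>, rescaling the level from \<beta> to
  \<open>a * \<beta>\<close> pulls \<open>a\<close> out of the positive part. For
  \<open>a = 0\<close> the right-hand side is 0 even if the CVaR is infinite, as 0 times \<infinity>
  is 0 in \<open>ereal\<close>.\<close>

lemma CVaR_cmult_le: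
  assumes "0 \<le> a" and [measurable]: "L \<in> borel_measurable P"
  shows "CVaR P \<epsilon> (\<lambda>x. a * L x) \<le> ereal a * CVaR P \<epsilon> L"
proof (cases "a = 0")
  case True
  then show ?thesis using CVaR_zero_le[of P \<epsilon>] by (simp add: zero_ereal_def[symmetric])
next
  case False
  with \<open>0 \<le> a\<close> have a: "0 < a" by simp
  let ?E = "\<lambda>L \<beta>. \<integral>\<^sup>+ x. ennreal (max (L x - \<beta>) 0) \<partial>P"
  \<comment> \<open>No sign condition on \<open>y\<close> is imposed: \<open>a\<close> and
    \<open>b\<close> are finite, so the sum is never of the form \<infinity> - \<infinity>.\<close>
  have factor: "ereal (a * b) + ereal e * (ereal a * y) = ereal a * (ereal b + ereal e * y)"
    for b e :: real and y :: ereal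
    by (subst mult.left_commute, subst ereal_distrib_left) auto
  \<comment> \<open>Dividing by \<open>a\<close> leaves the infimum alone on the right, so it is
    enough to compare with each level \<beta>.\<close>
  have "CVaR P \<epsilon> (\<lambda>x. a * L x) / ereal a \<le> CVaR P \<epsilon> L"
    unfolding CVaR_def[of P \<epsilon> L]
  proof (rule INF_greatest)
    fix \<beta>
    have "max (a * L x - a * \<beta>) 0 = a * max (L x - \<beta>) 0" for x
      using a by (simp add: max_mult_distrib_left right_diff_distrib)
    then have "?E (\<lambda>x. a * L x) (a * \<beta>) = (\<integral>\<^sup>+ x. ennreal a * ennreal (max (L x - \<beta>) 0) \<partial>P)"
      using a by (simp only: ennreal_mult'[OF less_imp_le])
    also have "\<dots> = ennreal a * ?E L \<beta>"
      by (rule nn_integral_cmult) simp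
    finally have E: "enn2ereal (?E (\<lambda>x. a * L x) (a * \<beta>)) = ereal a * enn2ereal (?E L \<beta>)"
      using a by (simp add: times_ennreal.rep_eq)
    have "CVaR P \<epsilon> (\<lambda>x. a * L x)
        \<le> ereal (a * \<beta>) + ereal (1 / \<epsilon>) * (ereal a * enn2ereal (?E L \<beta>))"
      using CVaR_le[of P \<epsilon> "\<lambda>x. a * L x" "a * \<beta>"] unfolding E .
    also have "\<dots> = ereal a * (ereal \<beta> + ereal (1 / \<epsilon>) * enn2ereal (?E L \<beta>))"
      by (rule factor)
    finally show "CVaR P \<epsilon> (\<lambda>x. a * L x) / ereal a
        \<le> ereal \<beta> + ereal (1 / \<epsilon>) * enn2ereal (?E L \<beta>)"
      using a by (simp add: ereal_divide_le_pos)
  qed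
  then show ?thesis
    using a by (simp add: ereal_divide_le_pos)
qed

lemma CVaR_sum_le:
  assumes "finite I" "0 < \<epsilon>" and meas: "\<And>i. i \<in> I \<Longrightarrow> L i \<in> borel_measurable P"
  shows "CVaR P \<epsilon> (\<lambda>x. \<Sum>i\<in>I. L i x) \<le> (\<Sum>i\<in>I. CVaR P \<epsilon> (L i))"
  using assms(1) meas
proof (induction I rule: finite_induct)
  case empty
  then show ?case by (simp add: CVaR_zero_le)
next
  case (insert i I)
  have "CVaR P \<epsilon> (\<lambda>x. L i x + (\<Sum>i\<in>I. L i x))
      \<le> CVaR P \<epsilon> (L i) + CVaR P \<epsilon> (\<lambda>x. \<Sum>i\<in>I. L i x)"
    using \<open>0 < \<epsilon>\<close> insert.prems by (intro CVaR_add_le borel_measurable_sum) auto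
  also have "\<dots> \<le> CVaR P \<epsilon> (L i) + (\<Sum>i\<in>I. CVaR P \<epsilon> (L i))"
    using insert by (intro add_left_mono) auto
  finally show ?case using insert.hyps by simp
qed

lemma CVaR_distr:
  assumes "f \<in> measurable P N" "L \<in> borel_measurable N"
  shows "CVaR (distr P N f) \<epsilon> L = CVaR P \<epsilon> (\<lambda>x. L (f x))"
  unfolding CVaR_def using assms by (simp add: nn_integral_distr)

text \<open>The norm is even, so square integrability survives the reflection, and in each
  covariance entry the two sign changes cancel.\<close>

lemma distr_uminus_in_distributions_with_moments:
  assumes "P \<in> distributions_with_moments \<mu> \<Sigma>"
  shows "distr P borel uminus \<in> distributions_with_moments (- \<mu>) \<Sigma>"
proof -
  from assms have P: "prob_space P" "integrable P (\<lambda>x. (norm x)\<^sup>2)"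
      "mean_vector P = \<mu>" "covariance_matrix P = \<Sigma>" and [measurable_cong]: "sets P = sets borel"
    by (auto simp: distributions_with_moments_def)
  have [measurable]: "uminus \<in> measurable P borel" by measurable
  have mean: "mean_vector (distr P borel uminus) = - \<mu>"
    using P(3) by (simp add: mean_vector_def integral_distr)
  \<comment> \<open>The left factors are the coordinates of -x centred at the reflected mean
    -\<mu>.\<close>
  have "(- x $ i + \<mu> $ i) * (- x $ j + \<mu> $ j) = (x $ i - \<mu> $ i) * (x $ j - \<mu> $ j)"
    for x :: "real ^ 'a" and i j
    by (simp add: algebra_simps)
  then have cov: "covariance_matrix (distr P borel uminus) = \<Sigma>"
    using P(3,4) by (simp add: covariance_matrix_def mean integral_distr)
  have "integrable (distr P borel uminus) (\<lambda>x. (norm x)\<^sup>2)"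
    using P(2) by (simp add: integrable_distr_eq)
  then show ?thesis
    using P(1) mean cov
    by (simp add: distributions_with_moments_def prob_space.prob_space_distr)
qed

theorem mainTheorem3:
  fixes \<epsilon> :: real and \<Sigma> :: "real ^ 'n ^ 'n" and q :: "real ^ 'n"
  assumes "0 < \<epsilon>" and "\<epsilon> < 1"
    and "symmetric_psd \<Sigma>"
  shows "worst_case_CVaR (distributions_with_moments 0 \<Sigma>) \<epsilon> (\<lambda>\<xi>. q \<bullet> \<xi>)
    \<le> (\<Sum>i\<in>UNIV. ereal \<bar>q $ i\<bar> * worst_case_CVaR (distributions_with_moments 0 \<Sigma>) \<epsilon> (\<lambda>\<xi>. \<xi> $ i))"
  unfolding worst_case_CVaR_def[of _ _ "\<lambda>\<xi>. q \<bullet> \<xi>"]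
proof (rule SUP_least)
  let ?W = "\<lambda>i. worst_case_CVaR (distributions_with_moments 0 \<Sigma>) \<epsilon> (\<lambda>\<xi>. \<xi> $ i)"
  fix P assume P: "P \<in> distributions_with_moments 0 \<Sigma>"
  then have [measurable_cong]: "sets P = sets borel"
    by (simp add: distributions_with_moments_def)
  have W: "CVaR Q \<epsilon> (\<lambda>\<xi>. \<xi> $ i) \<le> ?W i" if "Q \<in> distributions_with_moments 0 \<Sigma>" for Q i
    unfolding worst_case_CVaR_def using that by (rule SUP_upper)
  \<comment> \<open>With \<open>P\<close> fixed, each coordinate is bounded by its own supremum;
    different coordinates may approach theirs along different distributions.\<close>
  have le: "CVaR P \<epsilon> (\<lambda>\<xi>. q $ i * \<xi> $ i) \<le> ereal \<bar>q $ i\<bar> * ?W i" for i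
  proof (cases "0 \<le> q $ i")
    case True
    then have "CVaR P \<epsilon> (\<lambda>\<xi>. q $ i * \<xi> $ i) \<le> ereal \<bar>q $ i\<bar> * CVaR P \<epsilon> (\<lambda>\<xi>. \<xi> $ i)"
      using CVaR_cmult_le[of "q $ i" "\<lambda>\<xi>. \<xi> $ i" P \<epsilon>] by simp
    also have "\<dots> \<le> ereal \<bar>q $ i\<bar> * ?W i"
      using W[OF P] by (intro ereal_mult_left_mono) auto
    finally show ?thesis .
  next
    case False
    \<comment> \<open>Positive homogeneity needs a nonnegative factor, so the sign of
      \<open>q $ i\<close> is moved into the loss and from there into the distribution.\<close>
    then have "CVaR P \<epsilon> (\<lambda>\<xi>. q $ i * \<xi> $ i) \<le> ereal \<bar>q $ i\<bar> * CVaR P \<epsilon> (\<lambda>\<xi>. (- \<xi>) $ i)"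
      using CVaR_cmult_le[of "- q $ i" "\<lambda>\<xi>. - \<xi> $ i" P \<epsilon>] by simp
    also have "CVaR P \<epsilon> (\<lambda>\<xi>. (- \<xi>) $ i) = CVaR (distr P borel uminus) \<epsilon> (\<lambda>\<xi>. \<xi> $ i)"
      by (rule CVaR_distr[symmetric]) measurable
    also have "ereal \<bar>q $ i\<bar> * \<dots> \<le> ereal \<bar>q $ i\<bar> * ?W i"
      \<comment> \<open>The mean 0 enters here: the reflected mean - 0 is again 0, so the reflected
        law also competes in the supremum \<open>?W i\<close>.\<close>
      using distr_uminus_in_distributions_with_moments[OF P]
      by (intro ereal_mult_left_mono W) auto
    finally show ?thesis .
  qed
  have "CVaR P \<epsilon> (\<lambda>\<xi>. q \<bullet> \<xi>) \<le> (\<Sum>i\<in>UNIV. CVaR P \<epsilon> (\<lambda>\<xi>. q $ i * \<xi> $ i))"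
    unfolding inner_vec_def inner_real_def using \<open>0 < \<epsilon>\<close> by (intro CVaR_sum_le) auto
  also have "\<dots> \<le> (\<Sum>i\<in>UNIV. ereal \<bar>q $ i\<bar> * ?W i)"
    by (intro sum_mono le)
  finally show "CVaR P \<epsilon> (\<lambda>\<xi>. q \<bullet> \<xi>) \<le> (\<Sum>i\<in>UNIV. ereal \<bar>q $ i\<bar> * ?W i)" .
qed

end
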